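(* Let $-\pi/2<\alpha<\pi/2$ and let $f\in\mathcal{S}_\alpha$ with $f''(0)=0$. Then $$\|Pf\|\leq 2\cos\alpha .$$ The inequality is sharp, i.e. for each such $\alpha$ the constant $2\cos\alpha$ cannot be replaced by a smaller one.
   Context: $\mathbb{D}=\{z\in\mathbb{C}:|z|<1\}$. $\mathcal{A}$ is the class of analytic functions $f$ on $\mathbb{D}$ with $f(0)=0$ and $f'(0)=1$. For $-\pi/2<\alpha<\pi/2$, the (Robertson) class $\mathcal{S}_\alpha$ consists of those $f\in\mathcal{A}$ (with $f'$ non-vanishing on $\mathbb{D}$) satisfying $\mathrm{Re}\left\{e^{i\alpha}\left(1+zf''(z)/f'(z)\right)\right\}>0$ for all $z\in\mathbb{D}$. The pre-Schwarzian derivative of a locally univalent analytic $f$ is $Pf=f''/f'$, and its pre-Schwarzian norm is $\|Pf\|=\sup_{z\in\mathbb{D}}(1-|z|^2)\left|f''(z)/f'(z)\right|$. *)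

theory Defs
  imports "HOL-Complex_Analysis.Complex_Analysis" "HOL-Library.Extended_Real"
begin

definition normalized_analytic :: "(complex \<Rightarrow> complex) set" where
  "normalized_analytic = {f. f analytic_on ball 0 1 \<and> f 0 = 0 \<and> deriv f 0 = 1}"

definition pre_schwarzian :: "(complex \<Rightarrow> complex) \<Rightarrow> complex \<Rightarrow> complex" where
  "pre_schwarzian f z = deriv (deriv f) z / deriv f z"

text \<open>The supremum is taken in the extended reals, because it may be infinite for a general
  locally univalent function and a supremum over an unbounded set of reals is unspecified.\<close>

definition pre_schwarzian_norm :: "(complex \<Rightarrow> complex) \<Rightarrow> ereal" where
  "pre_schwarzian_norm f =
     (SUP z\<in>ball 0 1. ereal ((1 - (cmod z)\<^sup>2) * cmod (pre_schwarzian f z)))"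

definition robertson_class :: "real \<Rightarrow> (complex \<Rightarrow> complex) set" where
  "robertson_class \<alpha> = {f \<in> normalized_analytic.
     (\<forall>z\<in>ball 0 1. deriv f z \<noteq> 0) \<and>
     (\<forall>z\<in>ball 0 1. Re (exp (\<i> * of_real \<alpha>) * (1 + z * deriv (deriv f) z / deriv f z)) > 0)}"

end

theory Submission
  imports Defs
begin

text \<open>
  Put \<open>h(z) = e\<^sup>i\<^sup>\<alpha> Pf(z) / (2 cos \<alpha> + e\<^sup>i\<^sup>\<alpha> z Pf(z))\<close>. The Robertson condition says exactly that
  \<open>z h(z)\<close>, a Cayley transform of \<open>e\<^sup>i\<^sup>\<alpha> (1 + z Pf(z))\<close>, maps the disc into itself, and \<open>f''(0) = 0\<close>
  means \<open>h(0) = 0\<close>. Applying the Schwarz lemma twice gives \<open>|h(z)| \<le> |z|\<close>, which, solved for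
  \<open>Pf\<close>, is \<open>(1 - |z|\<^sup>2) |Pf(z)| \<le> 2 |z| cos \<alpha>\<close>. Equality on the positive radius holds for
  \<open>h(z) = z\<close>, that is, for \<open>f'(z) = (1 - z\<^sup>2) powr - (e\<^sup>-\<^sup>i\<^sup>\<alpha> cos \<alpha>)\<close>.
\<close>

text \<open>The Schwarz lemma for \<open>z * h z\<close> gives \<open>cmod (h z) \<le> 1\<close>
  away from the origin. By the maximum modulus principle, equality at one point would make
  \<open>h\<close> constant, against \<open>h 0 = 0\<close>. So \<open>h\<close> maps the disc into
  itself, and the Schwarz lemma applies to \<open>h\<close> as well.\<close>

lemma Schwarz_lemma_order2:
  assumes hol: "h holomorphic_on ball 0 1" and h0: "h 0 = 0"
    and bound: "\<And>z. cmod z < 1 \<Longrightarrow> cmod (z * h z) < 1" and z: "cmod z < 1"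
  shows "cmod (h z) \<le> cmod z"
proof -
  have le: "cmod (h z) \<le> 1" if "cmod z < 1" for z
  proof (cases "z = 0")
    case False
    have "cmod (z * h z) \<le> cmod z"
      by (rule Schwarz_Lemma(1)[of "\<lambda>z. z * h z"]) (use hol bound that in \<open>auto intro!: holomorphic_intros\<close>)
    with False show ?thesis by (simp add: norm_mult)
  qed (use h0 in simp)
  have less: "cmod (h z) < 1" if z: "cmod z < 1" for z
  proof (rule ccontr)
    assume "\<not> cmod (h z) < 1"
    with le[OF z] have eq: "cmod (h z) = 1" by simp
    have "h constant_on ball 0 1"
      by (rule maximum_modulus_principle[OF hol _ _ open_ball order_refl, of z])
        (use z eq le in auto)
    then have "h z = h 0" using z by (auto simp: constant_on_def)
    with h0 eq show False by simp
  qed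
  show ?thesis
    by (rule Schwarz_Lemma(1)[OF hol h0 less z])
qed

text \<open>The point \<open>p\<close> lies in the right half-plane, hence is closer to
  \<open>a\<close> than to \<open>- cnj a\<close>, the mirror image of \<open>a\<close> in the
  imaginary axis.\<close>

lemma Re_positive_imp_Cayley_less:
  fixes p a :: complex
  assumes "Re p > 0" "Re a > 0"
  shows "cmod (p - a) < cmod (p + cnj a)"
proof -
  have "(cmod (p + cnj a))\<^sup>2 - (cmod (p - a))\<^sup>2 = 4 * Re p * Re a"
    unfolding cmod_power2 by (simp add: power2_eq_square algebra_simps)
  also have "\<dots> > 0" using assms by simp
  finally show ?thesis by (simp add: power_less_imp_less_base)
qed

text \<open>The expression is the Cayley map \<open>(1 + w) / (1 - w)\<close> of the disc to the
  right half-plane, written in the form that the extremal function produces with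
  \<open>w = z\<^sup>2\<close>.\<close>

lemma Re_Cayley_pos:
  assumes "cmod w < 1"
  shows "Re (1 + 2 * w / (1 - w)) > 0"
proof -
  have "w \<noteq> 1" using assms by auto
  then have nz: "1 - w \<noteq> 0" by simp
  have "1 + 2 * w / (1 - w) = (1 + w) / (1 - w)" using nz by (simp add: field_simps)
  also have "Re \<dots> = (1 - (cmod w)\<^sup>2) / (cmod (1 - w))\<^sup>2"
    unfolding Re_divide cmod_power2 by (simp add: power2_eq_square algebra_simps)
  also have "\<dots> > 0" using assms nz by (simp add: abs_square_less_1)
  finally show ?thesis .
qed

lemma Re_exp_i_mult: "Re (exp (\<i> * of_real \<alpha>)) = cos \<alpha>"
  by (simp add: Re_exp)

lemma robertson_pre_schwarzian_bound:
  assumes f: "f \<in> robertson_class \<alpha>" and f2: "deriv (deriv f) 0 = 0"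
    and cos: "cos \<alpha> > 0" and z: "cmod z < 1"
  shows "(1 - (cmod z)\<^sup>2) * cmod (pre_schwarzian f z) \<le> 2 * cos \<alpha> * cmod z"
proof -
  define e where "e = exp (\<i> * of_real \<alpha>)"
  define P where "P = pre_schwarzian f"
  define h where "h z = e * P z / (2 * of_real (cos \<alpha>) + e * z * P z)" for z
  have norm_e: "cmod e = 1" by (simp add: e_def)
  have Re_e: "Re e = cos \<alpha>" by (simp add: e_def Re_exp_i_mult)
  have sum: "e + cnj e = 2 * of_real (cos \<alpha>)" by (simp add: complex_add_cnj Re_e)
  have fhol: "f holomorphic_on ball 0 1"
    and f1: "deriv f z \<noteq> 0"
    and Re_p: "Re (e * (1 + z * P z)) > 0" if "cmod z < 1" for z
    using f that by (auto simp: robertson_class_def normalized_analytic_def e_def P_def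
        pre_schwarzian_def analytic_imp_holomorphic)
  have Phol: "P holomorphic_on ball 0 1"
    unfolding P_def pre_schwarzian_def
    by (intro holomorphic_intros holomorphic_deriv fhol open_ball) (use f1 z in auto)
  \<comment> \<open>Take \<open>p = e * (1 + z * P z)\<close> and \<open>a = e\<close> in the Cayley
    inequality: \<open>p - a = e * z * P z\<close>, and \<open>e + cnj e\<close> supplies the
    constant \<open>2 * cos \<alpha>\<close> in \<open>p + cnj a\<close>.\<close>
  have less: "cmod (e * z * P z) < cmod (2 * of_real (cos \<alpha>) + e * z * P z)"
    if "cmod z < 1" for z
    using Re_positive_imp_Cayley_less[OF Re_p[OF that], of e] cos
    by (simp add: Re_e sum[symmetric] algebra_simps)
  then have nz: "2 * of_real (cos \<alpha>) + e * z * P z \<noteq> 0" if "cmod z < 1" for z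
    using that by fastforce
  have h: "cmod (h z) \<le> cmod z"
  proof (rule Schwarz_lemma_order2[OF _ _ _ z])
    show "h holomorphic_on ball 0 1"
      unfolding h_def by (intro holomorphic_intros Phol) (use nz in auto)
    show "h 0 = 0" by (simp add: h_def P_def pre_schwarzian_def f2)
    show "cmod (z * h z) < 1" if "cmod z < 1" for z
      using less[OF that] nz[OF that]
      by (simp add: h_def norm_divide norm_mult divide_simps mult_ac)
  qed
  \<comment> \<open>Clearing the denominator of \<open>h\<close> leaves \<open>P\<close> on both
    sides. After taking norms and using \<open>cmod (h z) \<le> cmod z\<close>, the term with
    \<open>P\<close> on the right moves to the left and forms the factor
    \<open>1 - (cmod z)\<^sup>2\<close>.\<close>
  have "e * P z = 2 * of_real (cos \<alpha>) * h z + z * h z * (e * P z)"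
  proof -
    have "h z * (2 * of_real (cos \<alpha>) + e * z * P z) = e * P z"
      using nz[OF z] by (simp add: h_def)
    then show ?thesis by (simp add: algebra_simps)
  qed
  then have "cmod (P z) = cmod (2 * of_real (cos \<alpha>) * h z + z * h z * (e * P z))"
    using norm_e by (metis mult_1 norm_mult)
  also have "\<dots> \<le> 2 * cos \<alpha> * cmod (h z) + cmod z * cmod (h z) * cmod (P z)"
    by (rule norm_triangle_le) (use cos norm_e in \<open>simp add: norm_mult\<close>)
  also have "\<dots> \<le> 2 * cos \<alpha> * cmod z + cmod z * cmod z * cmod (P z)"
    using h cos by (intro add_mono mult_mono) auto
  finally show ?thesis
    by (simp add: P_def power2_eq_square algebra_simps)
qed

lemma exists_robertson_extremal:
  assumes cos: "cos \<alpha> > 0"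
  obtains f where "f \<in> robertson_class \<alpha>" "deriv (deriv f) 0 = 0"
    "\<And>z. cmod z < 1 \<Longrightarrow>
      pre_schwarzian f z = 2 * of_real (cos \<alpha>) * exp (- (\<i> * of_real \<alpha>)) * z / (1 - z\<^sup>2)"
proof -
  define c where "c = of_real (cos \<alpha>) * exp (- (\<i> * of_real \<alpha>))"
  \<comment> \<open>\<open>F\<close> is the prescribed derivative; the function itself will be a
    primitive of \<open>F\<close>. The principal logarithm is holomorphic here because
    \<open>1 - z\<^sup>2\<close> stays in the right half-plane.\<close>
  define F where "F z = exp (- c * Ln (1 - z\<^sup>2))" for z
  have less: "cmod (z\<^sup>2) < 1" if "cmod z < 1" for z
    using that by (simp add: norm_power abs_square_less_1)
  have Re_pos: "Re (1 - z\<^sup>2) > 0" if "cmod z < 1" for z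
    using less[OF that] complex_Re_le_cmod[of "z\<^sup>2"] by simp
  have nz: "1 - z\<^sup>2 \<noteq> 0" if "cmod z < 1" for z
    using Re_pos[OF that] by force
  have dF: "(F has_field_derivative F z * (2 * c * z / (1 - z\<^sup>2))) (at z)" if "cmod z < 1" for z
    unfolding F_def using Re_pos[OF that] nz[OF that]
    by (auto intro!: derivative_eq_intros simp: complex_nonpos_Reals_iff field_simps)
  have Fhol: "F holomorphic_on ball 0 1"
    unfolding holomorphic_on_open[OF open_ball] using dF by (meson mem_ball_0)
  obtain g where "\<And>z. z \<in> ball 0 1 \<Longrightarrow> (g has_field_derivative F z) (at z within ball 0 1)"
    using holomorphic_convex_primitive'[OF convex_ball open_ball Fhol] by blast
  then have g: "(g has_field_derivative F z) (at z)" if "z \<in> ball 0 1" for z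
    using that by (metis at_within_open open_ball)
  define f where "f z = g z - g 0" for z
  have df: "(f has_field_derivative F z) (at z)" if "z \<in> ball 0 1" for z
    unfolding f_def using g[OF that] by (auto intro!: derivative_eq_intros)
  have d1: "deriv f z = F z" if "z \<in> ball 0 1" for z
    using df[OF that] by (rule DERIV_imp_deriv)
  have d2: "deriv (deriv f) z = F z * (2 * c * z / (1 - z\<^sup>2))" if "cmod z < 1" for z
  proof -
    \<comment> \<open>The derivative of \<open>f\<close> is known to be \<open>F\<close> only inside
      the disc, so differentiating once more needs equality on a neighbourhood of
      \<open>z\<close>.\<close>
    have "\<forall>\<^sub>F w in nhds z. deriv f w = F w"
      using eventually_nhds_in_open[of "ball 0 1" z] that
      by (auto elim!: eventually_mono intro: d1)
    then have "deriv (deriv f) z = deriv F z" by (rule deriv_cong_ev) simp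
    with DERIV_imp_deriv[OF dF[OF that]] show ?thesis by simp
  qed
  have F_nz: "F z \<noteq> 0" for z by (simp add: F_def)
  have "f holomorphic_on ball 0 1"
    unfolding holomorphic_on_open[OF open_ball] using df by blast
  then have "f \<in> normalized_analytic"
    by (auto simp: normalized_analytic_def analytic_on_open d1 f_def F_def)
  moreover have "Re (exp (\<i> * of_real \<alpha>) * (1 + z * deriv (deriv f) z / deriv f z)) > 0"
    if z: "cmod z < 1" for z
  proof -
    \<comment> \<open>The factor \<open>exp (- (\<i> * of_real \<alpha>))\<close> in
      \<open>c\<close> cancels the rotation in the Robertson condition. Only the leading term
      \<open>exp (\<i> * of_real \<alpha>)\<close> stays non-real in its coefficient, and its real
      part is \<open>cos \<alpha>\<close>, which then factors out.\<close>
    have ec: "exp (\<i> * of_real \<alpha>) * c = of_real (cos \<alpha>)"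
      by (simp add: c_def exp_minus field_simps)
    have "z * deriv (deriv f) z / deriv f z = c * (2 * z\<^sup>2 / (1 - z\<^sup>2))"
      using z F_nz[of z] by (simp add: d1 d2 power2_eq_square mult_ac)
    then have "exp (\<i> * of_real \<alpha>) * (1 + z * deriv (deriv f) z / deriv f z)
        = exp (\<i> * of_real \<alpha>) + (exp (\<i> * of_real \<alpha>) * c) * (2 * z\<^sup>2 / (1 - z\<^sup>2))"
      by (simp add: algebra_simps)
    then have "Re (exp (\<i> * of_real \<alpha>) * (1 + z * deriv (deriv f) z / deriv f z))
        = cos \<alpha> * Re (1 + 2 * z\<^sup>2 / (1 - z\<^sup>2))"
      unfolding ec
      by (simp only: plus_complex.sel times_complex.sel one_complex.sel Re_complex_of_real
          Im_complex_of_real Re_exp_i_mult distrib_left mult_zero_left diff_zero mult_1_right)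
    with cos Re_Cayley_pos[OF less[OF z]] show ?thesis by simp
  qed
  ultimately have "f \<in> robertson_class \<alpha>"
    by (auto simp: robertson_class_def d1 F_nz)
  moreover have "deriv (deriv f) 0 = 0" by (simp add: d2)
  moreover have "pre_schwarzian f z = 2 * of_real (cos \<alpha>) * exp (- (\<i> * of_real \<alpha>)) * z / (1 - z\<^sup>2)"
    if "cmod z < 1" for z
    using that F_nz[of z] by (simp add: pre_schwarzian_def d1 d2 c_def mult_ac)
  ultimately show thesis by (rule that)
qed

theorem theorem2p3:
  fixes \<alpha> :: real
  assumes "- pi / 2 < \<alpha>" and "\<alpha> < pi / 2"
  shows "(\<forall>f\<in>robertson_class \<alpha>. deriv (deriv f) 0 = 0 \<longrightarrow>
            pre_schwarzian_norm f \<le> ereal (2 * cos \<alpha>)) \<and>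
         (\<forall>C::real. C < 2 * cos \<alpha> \<longrightarrow>
            (\<exists>f\<in>robertson_class \<alpha>. deriv (deriv f) 0 = 0 \<and> \<not> pre_schwarzian_norm f \<le> ereal C))"
proof (intro conjI ballI allI impI)
  have cos: "cos \<alpha> > 0" using assms by (intro cos_gt_zero_pi) auto
  {
    fix f assume f: "f \<in> robertson_class \<alpha>" "deriv (deriv f) 0 = 0"
    have "(1 - (cmod z)\<^sup>2) * cmod (pre_schwarzian f z) \<le> 2 * cos \<alpha>" if "cmod z < 1" for z
      using robertson_pre_schwarzian_bound[OF f cos that]
      by (rule order_trans) (use cos that in simp)
    then show "pre_schwarzian_norm f \<le> ereal (2 * cos \<alpha>)"
      unfolding pre_schwarzian_norm_def by (intro SUP_least) auto
  }
  fix C :: real assume C: "C < 2 * cos \<alpha>"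
  obtain f where f: "f \<in> robertson_class \<alpha>" "deriv (deriv f) 0 = 0"
    and P: "\<And>z. cmod z < 1 \<Longrightarrow>
      pre_schwarzian f z = 2 * of_real (cos \<alpha>) * exp (- (\<i> * of_real \<alpha>)) * z / (1 - z\<^sup>2)"
    using exists_robertson_extremal[OF cos] by blast
  have "\<not> pre_schwarzian_norm f \<le> ereal C"
  proof
    assume le: "pre_schwarzian_norm f \<le> ereal C"
    have "2 * cos \<alpha> \<le> C"
    \<comment> \<open>On the positive radius the weight \<open>1 - x\<^sup>2\<close> cancels the
      denominator of the pre-Schwarzian, leaving \<open>x * (2 * cos \<alpha>)\<close>. The constant
      is approached as \<open>x\<close> tends to 1, so a bound for every \<open>x\<close> in the
      open interval suffices.\<close>
    proof (rule field_le_mult_one_interval)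
      fix x :: real assume x: "0 < x" "x < 1"
      have sq: "x\<^sup>2 < 1" using x by (simp add: abs_square_less_1)
      have "ereal ((1 - (cmod (of_real x))\<^sup>2) * cmod (pre_schwarzian f (of_real x))) \<le> ereal C"
        using le unfolding pre_schwarzian_norm_def SUP_le_iff by (rule bspec) (use x in simp)
      moreover have "cmod (1 - (of_real x)\<^sup>2) = 1 - x\<^sup>2"
        using sq norm_of_real[of "1 - x\<^sup>2", where 'a = complex] by simp
      then have "cmod (pre_schwarzian f (of_real x)) = x * (2 * cos \<alpha>) / (1 - x\<^sup>2)"
        using x cos by (simp add: P norm_mult norm_divide)
      ultimately show "x * (2 * cos \<alpha>) \<le> C"
        using sq by simp
    qed
    with C show False by simp
  qed
  with f show "\<exists>f\<in>robertson_class \<alpha>. deriv (deriv f) 0 = 0 \<and> \<not> pre_schwarzian_norm f \<le> ereal C"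
    by blast
qed

end
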